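(* Let $k\geq 3$ and $n\ge 1$ be integers, write $n=k^s t$, where $s\geq 0$ is maximal (equivalently, $k\nmid t$), and suppose that $t>1$. If $\lambda(k,t)=k/\gcd(k,t)\geq 3$, then $H_{k,n}$ is $2$-transitive on $\Omega_{k,n}$.
   Context: $\Omega_{k,n}=\{0,1,\ldots,kn-1\}$. Every $x\in\Omega_{k,n}$ is uniquely $x=an+b$ with $0\leq a<k$, $0\leq b<n$. Define permutations of $\Omega_{k,n}$ by $\sigma(an+b)=kb+a$ and $\rho(an+b)=((a+1)\bmod k)\,n+b$. $H_{k,n}=\langle\sigma,\rho\rangle\leq\operatorname{Sym}(\Omega_{k,n})$. A group is $2$-transitive if it is transitive on ordered pairs of distinct points. *)

theory Defs
  imports "HOL-Algebra.Bij" "HOL-Algebra.Generated_Groups"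
begin

definition Omega :: "nat \<Rightarrow> nat \<Rightarrow> nat set" where
  "Omega k n = {0..<k * n}"

(* Sym(Omega k n) is the library's BijGroup (Omega k n), whose elements are the bijections of
   Omega k n that are undefined outside of it; hence the restricted lambdas below.
   For x = a * n + b with a < k and b < n, a is x div n and b is x mod n. *)

definition sigma :: "nat \<Rightarrow> nat \<Rightarrow> nat \<Rightarrow> nat" where
  "sigma k n = (\<lambda>x\<in>Omega k n. k * (x mod n) + x div n)"

definition rho :: "nat \<Rightarrow> nat \<Rightarrow> nat \<Rightarrow> nat" where
  "rho k n = (\<lambda>x\<in>Omega k n. ((x div n + 1) mod k) * n + x mod n)"

definition H :: "nat \<Rightarrow> nat \<Rightarrow> (nat \<Rightarrow> nat) set" where
  "H k n = generate (BijGroup (Omega k n)) {sigma k n, rho k n}"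

definition two_transitive_on :: "('a \<Rightarrow> 'a) set \<Rightarrow> 'a set \<Rightarrow> bool" where
  "two_transitive_on G S \<longleftrightarrow>
     (\<forall>x\<in>S. \<forall>y\<in>S. \<forall>x'\<in>S. \<forall>y'\<in>S. x \<noteq> y \<longrightarrow> x' \<noteq> y' \<longrightarrow>
        (\<exists>g\<in>G. g x = x' \<and> g y = y'))"

(* The division is exact. *)
definition lam :: "nat \<Rightarrow> nat \<Rightarrow> nat" where
  "lam k t = k div gcd k t"

lemma Omega_memI:
  assumes "a < k" "b < n"
  shows "a * n + b \<in> Omega k n"
proof -
  have "a * n + b < (a + 1) * n" using assms by simp
  also have "\<dots> \<le> k * n" using assms by (intro mult_le_mono1) simp
  finally show ?thesis by (simp add: Omega_def)
qed

lemma Omega_memE: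
  assumes "x \<in> Omega k n"
  obtains a b where "a < k" "b < n" "x = a * n + b"
proof -
  have "n > 0" using assms by (cases n) (auto simp: Omega_def)
  moreover have "x div n < k"
    using assms by (simp add: Omega_def less_mult_imp_div_less)
  ultimately show ?thesis using that[of "x div n" "x mod n"] by simp
qed

lemma sigma_apply:
  assumes "a < k" "b < n"
  shows "sigma k n (a * n + b) = k * b + a"
  using assms Omega_memI[OF assms] by (simp add: sigma_def)

lemma rho_apply:
  assumes "a < k" "b < n"
  shows "rho k n (a * n + b) = ((a + 1) mod k) * n + b"
  using assms Omega_memI[OF assms] by (simp add: rho_def)

lemma sigma_in_Bij: "sigma k n \<in> Bij (Omega k n)"
proof -
  have "sigma k n ` Omega k n = Omega k n"
  proof (intro equalityI subsetI)
    fix y assume "y \<in> sigma k n ` Omega k n"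
    then obtain x where x: "x \<in> Omega k n" "y = sigma k n x" by blast
    from x(1) obtain a b where ab: "a < k" "b < n" "x = a * n + b" by (rule Omega_memE)
    have "b * k + a \<in> Omega n k" using ab by (intro Omega_memI)
    then show "y \<in> Omega k n" using x ab by (simp add: sigma_apply Omega_def mult.commute)
  next
    fix y assume "y \<in> Omega k n"
    then have "y \<in> Omega n k" by (simp add: Omega_def mult.commute)
    then obtain b a where ab: "b < n" "a < k" "y = b * k + a" by (rule Omega_memE)
    then have "y = sigma k n (a * n + b)" by (simp add: sigma_apply mult.commute)
    then show "y \<in> sigma k n ` Omega k n" using ab by (auto intro: Omega_memI)
  qed
  moreover from this have "inj_on (sigma k n) (Omega k n)"
    by (intro eq_card_imp_inj_on) (simp_all add: Omega_def)
  ultimately show ?thesis by (simp add: Bij_def bij_betw_def sigma_def)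
qed

lemma rho_in_Bij: "rho k n \<in> Bij (Omega k n)"
proof -
  have "rho k n ` Omega k n = Omega k n"
  proof (intro equalityI subsetI)
    fix y assume "y \<in> rho k n ` Omega k n"
    then obtain x where x: "x \<in> Omega k n" "y = rho k n x" by blast
    from x(1) obtain a b where ab: "a < k" "b < n" "x = a * n + b" by (rule Omega_memE)
    have "((a + 1) mod k) * n + b \<in> Omega k n" using ab by (intro Omega_memI) auto
    then show "y \<in> Omega k n" using x ab by (simp add: rho_apply)
  next
    fix y assume "y \<in> Omega k n"
    then obtain a b where ab: "a < k" "b < n" "y = a * n + b" by (rule Omega_memE)
    define a' where "a' = (a + (k - 1)) mod k"
    have a': "a' < k" using ab by (simp add: a'_def)
    have "(a' + 1) mod k = (a + (k - 1) + 1) mod k" unfolding a'_def by (rule mod_add_left_eq)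
    also have "\<dots> = a" using ab by simp
    finally have "y = rho k n (a' * n + b)" using ab a' by (simp add: rho_apply)
    then show "y \<in> rho k n ` Omega k n" using ab a' by (auto intro: Omega_memI)
  qed
  moreover from this have "inj_on (rho k n) (Omega k n)"
    by (intro eq_card_imp_inj_on) (simp_all add: Omega_def)
  ultimately show ?thesis by (simp add: Bij_def bij_betw_def rho_def)
qed

lemma H_subgroup: "subgroup (H k n) (BijGroup (Omega k n))"
  unfolding H_def
  by (rule group.generate_is_subgroup[OF group_BijGroup])
     (simp add: BijGroup_def sigma_in_Bij rho_in_Bij)

end

theory Submission
  imports Defs
begin

text \<open>
  Write \<open>x = \<alpha> * (k * t) + m\<close> with \<open>\<alpha> < k ^ s\<close> and \<open>m < k * t\<close>. The conjugate of \<open>\<rho>\<close> by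
  \<open>\<sigma> ^ s\<close> adds \<open>t\<close> to \<open>m\<close> modulo \<open>k * t\<close>, and the conjugate by \<open>\<sigma>\<^sup>-\<^sup>1\<close> rotates the lowest
  base-\<open>k\<close> digit of \<open>m\<close>; both fix \<open>\<alpha>\<close> and preserve \<open>m' - m\<close> modulo \<open>k\<close> for a pair of points.
  As \<open>\<lambda> \<ge> 3\<close>, this residue, if nonzero, is the only invariant of \<open>(m, m')\<close>. In particular a pair
  with nonzero residue can be moved so that its first point has \<open>m = 0\<close>.

  The powers of \<open>\<sigma>\<close> make the lowest digits of any two distinct points differ, and moves by \<open>\<sigma>\<^sup>-\<^sup>1\<close>
  then lead to a pair \<open>(0, y)\<close>, where \<open>y\<close> is given by \<open>s + 1\<close> nonzero digits: the base-\<open>k\<close> digits of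
  \<open>\<alpha>\<close> followed by the residue. A move by \<open>\<sigma>\<close> rotates this word and replaces one letter \<open>w\<close> by
  \<open>\<lceil>w / t\<rceil>\<close>. As \<open>t > 1\<close>, repeated sweeps turn every letter into \<open>1\<close>, so all pairs of distinct points
  lie in a single orbit.
\<close>

section \<open>Integer pairs under a common shift and low-digit rotation\<close>

text \<open>
  For \<open>k * q + u\<close> and \<open>k * q' + v\<close> with \<open>v - u\<close> fixed and nonzero modulo \<open>k\<close>, \<open>rot\<close> makes \<open>u\<close>
  arbitrary, so only \<open>(q, q')\<close> matters. Depending on \<open>u\<close>, adding \<open>t = k * c + w\<close> increments \<open>q\<close> and
  \<open>q'\<close> by \<open>c\<close> or \<open>c + 1\<close>; both mixed outcomes occur, and \<open>2 * w \<noteq> k\<close> gives one of the equal outcomes.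
\<close>

lemma pair_class_connected:
  fixes k t :: int and E :: "int \<times> int \<Rightarrow> int \<times> int \<Rightarrow> bool"
  assumes "equivp E"
    and k: "k > 0" "\<not> k dvd t" "2 * (t mod k) \<noteq> k"
    and shift: "\<And>X Y. E (X, Y) (X + t, Y + t)"
    and rot: "\<And>q q' u v. \<lbrakk>0 \<le> u; u < k; 0 \<le> v; v < k\<rbrakk> \<Longrightarrow>
      E (k * q + u, k * q' + v) (k * q + (u + 1) mod k, k * q' + (v + 1) mod k)"
    and r: "\<not> k dvd Y - X" "(Y - X) mod k = (Y' - X') mod k"
  shows "E (X, Y) (X', Y')"
proof -
  note E_refl = equivp_reflp[OF \<open>equivp E\<close>]
    and E_sym = equivp_symp[OF \<open>equivp E\<close>]
    and E_trans = equivp_transp[OF \<open>equivp E\<close>]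
  define r where "r = (Y - X) mod k"
  define w where "w = t mod k"
  define c where "c = t div k"
  have r_bounds: "0 < r" "r < k"
    using k(1) r(1) pos_mod_bound[of k "Y - X"] pos_mod_sign[of k "Y - X"]
    unfolding r_def dvd_eq_mod_eq_0 by linarith+
  have w_bounds: "0 < w" "w < k"
    using k(1,2) pos_mod_bound[of k t] pos_mod_sign[of k t]
    unfolding w_def dvd_eq_mod_eq_0 by linarith+
  have t_eq: "t = k * c + w" by (simp add: c_def w_def)
  \<comment> \<open>Every pair of residue difference \<open>r\<close> has this form with
    \<open>0 \<le> u < k\<close>: the first low digit \<open>u\<close> fixes the second.\<close>
  define F where "F q q' u = (k * q + u, k * q' + (u + r) mod k)" for q q' u :: int
  have F_step: "E (F q q' u) (F q q' ((u + 1) mod k))" if "0 \<le> u" "u < k" for q q' u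
  proof -
    have "((u + r) mod k + 1) mod k = ((u + 1) mod k + r) mod k"
      by (simp add: mod_simps algebra_simps)
    then show ?thesis using rot[of u "(u + r) mod k" q q'] that k by (simp add: F_def)
  qed
  have F_0: "E (F q q' 0) (F q q' u)" if "0 \<le> u" "u < k" for q q' u
  proof -
    have "E (F q q' 0) (F q q' (int i))" if "int i < k" for i
      using that
    proof (induction i)
      case 0
      then show ?case by (simp add: E_refl)
    next
      case (Suc i)
      then have "E (F q q' (int i)) (F q q' ((int i + 1) mod k))" by (intro F_step) auto
      moreover have "(int i + 1) mod k = int (Suc i)" using Suc.prems by simp
      ultimately show ?case using Suc by (auto intro: E_trans)
    qed
    from this[of "nat u"] that show ?thesis by simp
  qed
  have F_any: "E (F q q' u) (F q q' v)" if "0 \<le> u" "u < k" "0 \<le> v" "v < k" for q q' u v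
    using F_0[of u] F_0[of v] that by (blast intro: E_sym E_trans)
  \<comment> \<open>Adding \<open>t\<close> adds \<open>w\<close> to both low digits, and
    \<open>e\<close>, \<open>e'\<close> are the resulting carries. Rotation brings the first low
    digit to 0 at both ends.\<close>
  have move: "E (F q q' 0) (F (q + c + e) (q' + c + e') 0)"
    if u: "0 \<le> u" "u < k" and x: "0 \<le> u + w - k * e" "u + w - k * e < k"
      and y: "0 \<le> (u + r) mod k + w - k * e'" "(u + r) mod k + w - k * e' < k"
    for q q' u e e'
  proof -
    have "(u + w - k * e + r) mod k = (u + r + w) mod k"
      by (metis add_diff_eq diff_add_eq mod_mult_self4 mult_minus_right uminus_add_conv_diff
          add.commute add.assoc)
    also have "\<dots> = ((u + r) mod k + w - k * e') mod k"
      by (metis mod_add_left_eq mod_mult_self4 mult_minus_right uminus_add_conv_diff)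
    also have "\<dots> = (u + r) mod k + w - k * e'" using y by simp
    finally have eq: "F (q + c + e) (q' + c + e') (u + w - k * e) =
        (k * q + u + t, k * q' + (u + r) mod k + t)"
      by (simp add: F_def t_eq algebra_simps)
    have "E (F q q' u) (F (q + c + e) (q' + c + e') (u + w - k * e))"
      unfolding eq by (simp add: F_def shift)
    then show ?thesis using F_0[OF u] F_any[OF x, of 0] k
      by (meson E_trans order_refl)
  qed
  have mod_low: "(u + r) mod k = u + r" if "0 \<le> u" "u + r < k" for u
    using that r_bounds by simp
  have mod_high: "(u + r) mod k = u + r - k" if "u < k" "u + r \<ge> k" for u
    using that r_bounds by (metis add_less_le_mono diff_add_cancel diff_ge_0_iff_ge less_imp_le
        minus_mod_self2 mod_pos_pos_trivial diff_less_eq)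
  have right: "E (F q q' 0) (F (q + c) (q' + c + 1) 0)" for q q'
  proof -
    \<comment> \<open>The largest \<open>u\<close> for which neither \<open>u + r\<close> nor
      \<open>u + w\<close> reaches \<open>k\<close>. Then
      \<open>u + r + w = k + min r w - 1\<close>, so only the second entry carries.\<close>
    define u where "u = k - max r w - 1"
    have "(u + r) mod k = u + r" using r_bounds w_bounds by (intro mod_low) (auto simp: u_def)
    then show ?thesis using move[of u 0 1 q q'] r_bounds w_bounds by (auto simp: u_def)
  qed
  have left: "E (F q q' 0) (F (q + c + 1) (q' + c) 0)" for q q'
  proof -
    \<comment> \<open>Now \<open>u + w \<ge> k\<close> makes the first entry carry, while the second
      low digit \<open>r - min r w\<close> plus \<open>w\<close> is
      \<open>max r w < k\<close>.\<close>
    define u where "u = k - min r w"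
    have "(u + r) mod k = u + r - k"
      using r_bounds w_bounds by (intro mod_high) (auto simp: u_def)
    then show ?thesis using move[of u 1 0 q q'] r_bounds w_bounds by (auto simp: u_def)
  qed
  \<comment> \<open>If all four failed, then \<open>w = r = k - r\<close>, so
    \<open>2 * w = k\<close>.\<close>
  have "w < r \<or> w < k - r \<or> w > r \<or> w > k - r" using k by (auto simp: w_def)
  then have diag: "(\<forall>q q'. E (F q q' 0) (F (q + c) (q' + c) 0)) \<or>
      (\<forall>q q'. E (F q q' 0) (F (q + c + 1) (q' + c + 1) 0))"
  proof (elim disjE)
    assume "w < r"
    then show ?thesis using move[of "k - r" 0 0] r_bounds w_bounds mod_high[of "k - r"] by auto
  next
    assume "w < k - r"
    then show ?thesis using move[of 0 0 0] r_bounds w_bounds mod_low[of 0] by auto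
  next
    assume "w > r"
    then show ?thesis using move[of "k - w" 1 1] r_bounds w_bounds mod_low[of "k - w"] by auto
  next
    assume "w > k - r"
    then show ?thesis using move[of "k - 1" 1 1] r_bounds w_bounds mod_high[of "k - 1"] by auto
  qed
  \<comment> \<open>The unit vectors are differences of a mixed step, \<open>(c + 1, c)\<close> or
    \<open>(c, c + 1)\<close>, and the available equal step.\<close>
  have inc: "E (F q q' 0) (F (q + 1) q' 0) \<and> E (F q q' 0) (F q (q' + 1) 0)" for q q'
    using diag
  proof
    assume *: "\<forall>q q'. E (F q q' 0) (F (q + c) (q' + c) 0)"
    have "E (F q q' 0) (F (q - c) (q' - c) 0)" using *[rule_format, of "q - c" "q' - c"]
      by (simp add: E_sym)
    then show ?thesis using left[of "q - c" "q' - c"] right[of "q - c" "q' - c"]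
      by (auto intro: E_trans)
  next
    assume *: "\<forall>q q'. E (F q q' 0) (F (q + c + 1) (q' + c + 1) 0)"
    have 1: "E (F q q' 0) (F (q - c) (q' - c - 1) 0)"
      using left[of "q - c - 1" "q' - c"] right[of "q - c" "q' - c - 1"] by (simp add: E_sym)
    have 2: "E (F q q' 0) (F (q - c - 1) (q' - c) 0)"
      using left[of "q - c - 1" "q' - c"] by (simp add: E_sym)
    show ?thesis
      using E_trans[OF 1] *[rule_format, of "q - c" "q' - c - 1"]
        E_trans[OF 2] *[rule_format, of "q - c - 1" "q' - c"] by simp
  qed
  have inc1: "E (F q q' 0) (F 0 q' 0)" for q q'
  proof (induction q rule: int_induct[where k = 0])
    case base
    show ?case by (rule E_refl)
  next
    case (step1 i)
    with inc[of i q'] show ?case by (blast intro: E_sym E_trans)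
  next
    case (step2 i)
    with inc[of "i - 1" q'] show ?case by (auto intro: E_trans)
  qed
  have inc2: "E (F 0 q' 0) (F 0 0 0)" for q'
  proof (induction q' rule: int_induct[where k = 0])
    case base
    show ?case by (rule E_refl)
  next
    case (step1 i)
    with inc[of 0 i] show ?case by (blast intro: E_sym E_trans)
  next
    case (step2 i)
    with inc[of 0 "i - 1"] show ?case by (auto intro: E_trans)
  qed
  have canonical: "E (A, B) (F 0 0 0)" if "(B - A) mod k = r" for A B
  proof -
    have "B mod k = (A mod k + r) mod k"
      by (metis add.commute diff_add_cancel mod_add_eq mod_mod_trivial that)
    then have "(A, B) = F (A div k) (B div k) (A mod k)"
      unfolding F_def by (metis mult_div_mod_eq)
    moreover have "E (F (A div k) (B div k) (A mod k)) (F (A div k) (B div k) 0)"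
      using k by (intro F_any) auto
    ultimately show ?thesis using inc1 inc2 by (metis E_trans)
  qed
  show ?thesis using canonical[of Y X] canonical[of Y' X'] r
    by (auto simp: r_def intro: E_sym E_trans)
qed

section \<open>Orbits on ordered pairs\<close>

text \<open>Elements of \<open>H k n\<close> are \<open>undefined\<close> off
  \<open>Omega k n\<close>; hence the membership assumptions in the equivalence laws below.\<close>

definition orb :: "nat \<Rightarrow> nat \<Rightarrow> nat \<times> nat \<Rightarrow> nat \<times> nat \<Rightarrow> bool" where
  "orb k n p q \<longleftrightarrow> (\<exists>g \<in> H k n. g (fst p) = fst q \<and> g (snd p) = snd q)"

lemma H_subset_Bij: "H k n \<subseteq> Bij (Omega k n)"
  using subgroup.subset[OF H_subgroup] by (simp add: BijGroup_def)

lemma orb_refl: "x \<in> Omega k n \<Longrightarrow> y \<in> Omega k n \<Longrightarrow> orb k n (x, y) (x, y)"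
  using subgroup.one_closed[OF H_subgroup, of k n]
  by (auto simp: orb_def BijGroup_def intro!: bexI[of _ "\<lambda>x\<in>Omega k n. x"])

lemma orb_trans:
  assumes "orb k n (x, y) (x', y')" "orb k n (x', y') (x'', y'')"
    and "x \<in> Omega k n" "y \<in> Omega k n"
  shows "orb k n (x, y) (x'', y'')"
proof -
  from assms obtain g h where g: "g \<in> H k n" "g x = x'" "g y = y'"
    and h: "h \<in> H k n" "h x' = x''" "h y' = y''" by (auto simp: orb_def)
  have "h \<otimes>\<^bsub>BijGroup (Omega k n)\<^esub> g \<in> H k n"
    using g h by (intro subgroup.m_closed[OF H_subgroup])
  moreover have "h \<otimes>\<^bsub>BijGroup (Omega k n)\<^esub> g = compose (Omega k n) h g"
    using g h H_subset_Bij[of k n] by (simp add: BijGroup_def subset_iff)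
  ultimately show ?thesis using assms(3,4) g h
    by (auto simp: orb_def compose_def intro!: bexI[of _ "compose (Omega k n) h g"])
qed

lemma orb_sym:
  assumes "orb k n (x, y) (x', y')" "x \<in> Omega k n" "y \<in> Omega k n"
  shows "orb k n (x', y') (x, y)"
proof -
  from assms obtain g where g: "g \<in> H k n" "g x = x'" "g y = y'" by (auto simp: orb_def)
  have B: "g \<in> Bij (Omega k n)" using g H_subset_Bij by blast
  have "inv\<^bsub>BijGroup (Omega k n)\<^esub> g \<in> H k n"
    using g by (intro subgroup.m_inv_closed[OF H_subgroup])
  moreover have "inv\<^bsub>BijGroup (Omega k n)\<^esub> g = (\<lambda>x\<in>Omega k n. inv_into (Omega k n) g x)"
    by (rule inv_BijGroup[OF B])
  moreover have "x' \<in> Omega k n" "y' \<in> Omega k n"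
    "inv_into (Omega k n) g x' = x" "inv_into (Omega k n) g y' = y"
    using B g assms by (auto simp: Bij_def bij_betw_def)
  ultimately show ?thesis
    by (auto simp: orb_def intro!: bexI[of _ "inv\<^bsub>BijGroup (Omega k n)\<^esub> g"])
qed

lemma orb_in_Omega:
  assumes "orb k n (x, y) (x', y')" "x \<in> Omega k n" "y \<in> Omega k n"
  shows "x' \<in> Omega k n" "y' \<in> Omega k n"
  using assms H_subset_Bij[of k n] by (auto simp: orb_def Bij_def bij_betw_def)

lemma orb_sigma: "orb k n (x, y) (sigma k n x, sigma k n y)"
  unfolding orb_def H_def by (rule bexI[of _ "sigma k n"]) (auto intro: generate.incl)

lemma orb_rho: "orb k n (x, y) (rho k n x, rho k n y)"
  unfolding orb_def H_def by (rule bexI[of _ "rho k n"]) (auto intro: generate.incl)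

lemma sigma_in_Omega: "x \<in> Omega k n \<Longrightarrow> sigma k n x \<in> Omega k n"
  using orb_in_Omega(1)[OF orb_sigma[of k n x x]] by blast

text \<open>Apply \<open>sigma\<close>, the given move, then the inverse of \<open>sigma\<close>:
  this yields conjugates without a formula for that inverse.\<close>

lemma orb_conj:
  assumes "x \<in> Omega k n" "y \<in> Omega k n" "x' \<in> Omega k n" "y' \<in> Omega k n"
    and "orb k n (sigma k n x, sigma k n y) (sigma k n x', sigma k n y')"
  shows "orb k n (x, y) (x', y')"
  using assms orb_sigma orb_sym orb_trans by (meson sigma_in_Omega)

section \<open>Conjugates of \<open>rho\<close> in base-\<open>k\<close> digits\<close>

lemma rho_eq_mod: "x \<in> Omega k n \<Longrightarrow> rho k n x = (x + n) mod (k * n)"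
proof -
  assume x: "x \<in> Omega k n"
  then have "n > 0" by (cases n) (auto simp: Omega_def)
  have "(x + n) mod (n * k) = n * ((x + n) div n mod k) + (x + n) mod n" by (rule mod_mult2_eq)
  also have "(x + n) div n = x div n + 1" using \<open>n > 0\<close> div_mult_self1[of n x 1] by simp
  finally show ?thesis using x by (simp add: rho_def mult.commute)
qed

text \<open>\<open>sigma\<close> carries the leading digit \<open>a\<close> to the end and
  multiplies the rest by \<open>k\<close>, so the low block grows from size \<open>M\<close> to
  \<open>k * M\<close>.\<close>

lemma sigma_drop_digit:
  assumes "K * M = n" "a < k" "\<alpha> < K" "m < M"
  shows "sigma k n ((a * K + \<alpha>) * M + m) = \<alpha> * (k * M) + (k * m + a)"
proof -
  have "\<alpha> * M + m < n" using Omega_memI[OF assms(3,4)] assms(1) by (simp add: Omega_def)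
  moreover have "(a * K + \<alpha>) * M + m = a * n + (\<alpha> * M + m)"
    using assms(1) by (simp add: algebra_simps)
  ultimately have "sigma k n ((a * K + \<alpha>) * M + m) = k * (\<alpha> * M + m) + a"
    using assms(2) by (simp only: sigma_apply)
  then show ?thesis by (simp add: algebra_simps)
qed

text \<open>Induction by conjugating with \<open>sigma\<close>: it takes \<open>m\<close> to
  \<open>k * m + d\<close>, and adding \<open>k * P\<close> modulo \<open>k * (k * P)\<close> there
  amounts to adding \<open>P\<close> to \<open>m\<close> modulo \<open>k * P\<close>. The base case
  is \<open>rho\<close> itself.\<close>

lemma orb_shift_block:
  assumes "k > 0" "k ^ j * P = n" "\<alpha> < k ^ j" "\<beta> < k ^ j" "m < k * P" "m' < k * P"
  shows "orb k n (\<alpha> * (k * P) + m, \<beta> * (k * P) + m')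
    (\<alpha> * (k * P) + (m + P) mod (k * P), \<beta> * (k * P) + (m' + P) mod (k * P))"
  using assms
proof (induction j arbitrary: P \<alpha> \<beta> m m')
  case 0
  then show ?case using orb_rho[of k n m m'] by (simp add: rho_eq_mod Omega_def)
next
  case (Suc j)
  have n: "k ^ j * (k * P) = n" using Suc.prems by (simp add: algebra_simps)
  have P: "k * P > 0" using Suc.prems(5) by (rule le_less_trans[OF le0])
  have in_Omega: "\<gamma> * (k * P) + p \<in> Omega k n" if "\<gamma> < k ^ Suc j" "p < k * P" for \<gamma> p
    using Omega_memI[OF that] unfolding Omega_def Suc.prems(2)[symmetric] by (simp add: ac_simps)
  have sigma: "sigma k n (\<gamma> * (k * P) + p) =
      (\<gamma> mod k ^ j) * (k * (k * P)) + (k * p + \<gamma> div k ^ j)"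
    and top: "\<gamma> div k ^ j < k" and low: "\<gamma> mod k ^ j < k ^ j"
    if "\<gamma> < k ^ Suc j" "p < k * P" for \<gamma> p
  proof -
    show top: "\<gamma> div k ^ j < k" using that by (simp add: less_mult_imp_div_less)
    show low: "\<gamma> mod k ^ j < k ^ j" using Suc.prems(1) by simp
    show "sigma k n (\<gamma> * (k * P) + p) =
      (\<gamma> mod k ^ j) * (k * (k * P)) + (k * p + \<gamma> div k ^ j)"
      using sigma_drop_digit[OF n top low that(2)] by (simp only: div_mult_mod_eq)
  qed
  have shift: "(k * p + d + k * P) mod (k * (k * P)) = k * ((p + P) mod (k * P)) + d"
    if "d < k" for p d
  proof -
    have "k * p + d + k * P = k * (p + P) + d" by (simp add: algebra_simps)
    then show ?thesis using that
      by (simp only: mod_mult2_eq) (simp add: Suc.prems(1))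
  qed
  have lt: "k * p + d < k * (k * P)" if "p < k * P" "d < k" for p d
    using Omega_memI[OF that] by (simp add: Omega_def algebra_simps)
  note x = Suc.prems(3,5) and y = Suc.prems(4,6)
  have less: "(p + P) mod (k * P) < k * P" for p using P by simp
  note x' = Suc.prems(3) less[of m] and y' = Suc.prems(4) less[of m']
  have "orb k n (sigma k n (\<alpha> * (k * P) + m), sigma k n (\<beta> * (k * P) + m'))
    (sigma k n (\<alpha> * (k * P) + (m + P) mod (k * P)),
     sigma k n (\<beta> * (k * P) + (m' + P) mod (k * P)))"
    using Suc.IH[OF Suc.prems(1) n low[OF x] low[OF y]
        lt[OF x(2) top[OF x]] lt[OF y(2) top[OF y]]]
    by (simp only: sigma[OF x] sigma[OF y] sigma[OF x'] sigma[OF y']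
        shift[OF top[OF x]] shift[OF top[OF y]])
  then show ?case
    by (rule orb_conj[OF in_Omega[OF x] in_Omega[OF y] in_Omega[OF x'] in_Omega[OF y']])
qed

text \<open>\<open>sigma\<close> turns the leading digit into the last one, so undoing
  \<open>sigma\<close>, applying \<open>rho\<close> and redoing \<open>sigma\<close> rotates the
  last digit.\<close>

lemma orb_rotate_low_digit:
  assumes "e < n" "e' < n" "u < k" "v < k"
  shows "orb k n (k * e + u, k * e' + v) (k * e + (u + 1) mod k, k * e' + (v + 1) mod k)"
proof -
  let ?x = "u * n + e" and ?y = "v * n + e'"
  have \<Omega>: "?x \<in> Omega k n" "?y \<in> Omega k n" using assms by (auto intro: Omega_memI)
  have "orb k n (sigma k n ?x, sigma k n ?y) (?x, ?y)"
    by (rule orb_sym[OF orb_sigma \<Omega>])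
  moreover have "orb k n (?x, ?y) (sigma k n (rho k n ?x), sigma k n (rho k n ?y))"
    by (rule orb_trans[OF orb_rho orb_sigma \<Omega>])
  ultimately have "orb k n (sigma k n ?x, sigma k n ?y)
      (sigma k n (rho k n ?x), sigma k n (rho k n ?y))"
    by (rule orb_trans) (simp_all add: \<Omega> sigma_in_Omega)
  then show ?thesis using assms by (simp add: rho_apply sigma_apply)
qed

text \<open>Here \<open>t mod k\<close> divides \<open>k\<close>, so it is the gcd. In
  contrapositive form this is how \<open>lam k t \<ge> 3\<close> enters.\<close>

lemma half_imp_lam_eq_2:
  assumes "k > 0" "2 * (t mod k) = k"
  shows "lam k t = 2"
proof -
  have "gcd k t = gcd (t mod k) k" by (metis gcd.commute gcd_red_nat)
  also have "\<dots> = t mod k" using assms(2) by (metis dvd_triv_right gcd_nat.absorb1)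
  finally have "gcd k t = t mod k" .
  with assms show ?thesis by (metis lam_def nonzero_mult_div_cancel_right mult_0_right less_irrefl)
qed

section \<open>Free movement of the low parts\<close>

locale cyclic_shuffle =
  fixes k n s t :: nat
  assumes k_ge: "k \<ge> 3" and n_eq: "n = k ^ s * t" and not_dvd: "\<not> k dvd t"
    and t_gt: "t > 1" and lam_ge: "lam k t \<ge> 3"
begin

lemma point_in_Omega: "\<alpha> < k ^ s \<Longrightarrow> m < k * t \<Longrightarrow> \<alpha> * (k * t) + m \<in> Omega k n"
  using Omega_memI[of \<alpha> "k ^ s" m "k * t"] by (simp add: Omega_def n_eq algebra_simps)

lemma orb_low_parts:
  assumes "\<alpha> < k ^ s" "\<beta> < k ^ s"
    and bounds: "m < k * t" "m' < k * t" "p < k * t" "p' < k * t"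
    and diff: "m mod k \<noteq> m' mod k" "(int m' - int m) mod int k = (int p' - int p) mod int k"
  shows "orb k n (\<alpha> * (k * t) + m, \<beta> * (k * t) + m') (\<alpha> * (k * t) + p, \<beta> * (k * t) + p')"
proof -
  \<comment> \<open>\<open>pair_class_connected\<close> speaks of all integer pairs, so low parts
    are read modulo \<open>k * t\<close>. This respects the last digit, as \<open>k\<close> divides
    \<open>k * t\<close>.\<close>
  define red where "red X = nat (X mod (int k * int t))" for X
  have red_lt: "red X < k * t" for X
    using k_ge t_gt by (simp add: red_def nat_less_iff)
  have red_int: "red (int q) = q" if "q < k * t" for q
    using that by (simp add: red_def flip: of_nat_mult zmod_int)
  define E where "E P Q \<longleftrightarrow> orb k n (\<alpha> * (k * t) + red (fst P), \<beta> * (k * t) + red (snd P))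
      (\<alpha> * (k * t) + red (fst Q), \<beta> * (k * t) + red (snd Q))" for P Q
  have \<Omega>: "\<alpha> * (k * t) + red X \<in> Omega k n" "\<beta> * (k * t) + red X \<in> Omega k n" for X
    using assms(1,2) red_lt by (auto intro: point_in_Omega)
  have "equivp E"
  proof (intro equivpI reflpI sympI transpI)
    show "E P P" for P unfolding E_def by (intro orb_refl \<Omega>)
    show "E Q P" if "E P Q" for P Q 
      unfolding E_def by (rule orb_sym[OF that[unfolded E_def] \<Omega>])
    show "E P R" if "E P Q" "E Q R" for P Q R
      unfolding E_def by (rule orb_trans[OF that[unfolded E_def] \<Omega>])
  qed
  moreover have "E (X, Y) (X + int t, Y + int t)" for X Y
  proof -
    have "red (Z + int t) = (red Z + t) mod (k * t)" for Z
      using k_ge t_gt by (simp add: red_def nat_eq_iff zmod_int mod_add_left_eq)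
    then show ?thesis
      using orb_shift_block[of k s t n \<alpha> \<beta> "red X" "red Y"] assms(1,2) red_lt k_ge n_eq
      by (simp add: E_def)
  qed
  moreover have "E (int k * q + u, int k * q' + v)
      (int k * q + (u + 1) mod int k, int k * q' + (v + 1) mod int k)"
    if uv: "0 \<le> u" "u < int k" "0 \<le> v" "v < int k" for q q' u v
  proof -
    have red_eq: "red (int k * q + u) = k * nat (q mod int t) + nat u"
      if "0 \<le> u" "u < int k" for q u
    proof -
      have "(int k * q + u) mod (int k * int t) = int k * (q mod int t) + u"
        using that by (simp add: zmod_zmult2_eq)
      then show ?thesis using that t_gt by (simp add: red_def nat_add_distrib nat_mult_distrib)
    qed
    have lt: "\<gamma> * t + nat (q mod int t) < n" if "\<gamma> < k ^ s" for \<gamma> q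
      using Omega_memI[OF that, of "nat (q mod int t)" t] t_gt
      by (simp add: Omega_def n_eq nat_less_iff)
    have nat_eq: "nat ((u + 1) mod int k) = (nat u + 1) mod k" if "0 \<le> u" for u
      using that by (simp add: nat_mod_distrib nat_add_distrib)
    have split: "\<gamma> * (k * t) + (k * e + d) = k * (\<gamma> * t + e) + d" for \<gamma> e d
      by (simp add: algebra_simps)
    have less: "nat u < k" "nat v < k" using uv by auto
    show ?thesis
      using orb_rotate_low_digit[OF lt[OF assms(1)] lt[OF assms(2)] less, of q q'] uv k_ge
      by (simp add: E_def red_eq nat_eq split)
  qed
  moreover have "\<not> int k dvd int t" using not_dvd by simp
  moreover have "2 * (int t mod int k) \<noteq> int k"
    using half_imp_lam_eq_2[of k t] k_ge lam_ge by (auto simp flip: zmod_int)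
  moreover have "\<not> int k dvd int m' - int m"
    using diff(1) by (metis mod_eq_dvd_iff of_nat_eq_iff zmod_int)
  ultimately have "E (int m, int m') (int p, int p')"
    using pair_class_connected[of E "int k" "int t" "int m'" "int m" "int p'" "int p"] k_ge diff(2)
    by simp
  then show ?thesis using bounds by (simp add: E_def red_int)
qed

section \<open>Words of base-\<open>k\<close> digits\<close>

definition horner :: "nat list \<Rightarrow> nat" where
  "horner ds = foldl (\<lambda>a d. a * k + d) 0 ds"

lemma horner_Nil [simp]: "horner [] = 0"
  by (simp add: horner_def)

lemma horner_snoc [simp]: "horner (ds @ [d]) = horner ds * k + d"
  by (simp add: horner_def)

lemma horner_Cons: "horner (d # ds) = d * k ^ length ds + horner ds"
proof (induction ds rule: rev_induct)
  case Nil
  show ?case using horner_snoc[of "[]" d] by simp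
next
  case (snoc e es)
  have "horner (d # es @ [e]) = horner (d # es) * k + e" using horner_snoc[of "d # es" e] by simp
  with snoc show ?case by (simp add: algebra_simps)
qed

lemma horner_less: "set ds \<subseteq> {..<k} \<Longrightarrow> horner ds < k ^ length ds"
proof (induction ds rule: rev_induct)
  case (snoc d ds)
  then show ?case using Omega_memI[of "horner ds" "k ^ length ds" d k]
    by (simp add: Omega_def mult.commute)
qed simp

lemma horner_replicate_0 [simp]: "horner (replicate i 0) = 0"
  by (induction i) (simp_all add: horner_Cons)

lemma ex_horner: "x < k ^ i \<Longrightarrow> \<exists>ds. length ds = i \<and> set ds \<subseteq> {..<k} \<and> horner ds = x"
proof (induction i arbitrary: x)
  case (Suc i)
  then have "x div k < k ^ i" by (simp add: less_mult_imp_div_less mult.commute)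
  then obtain ds where "length ds = i" "set ds \<subseteq> {..<k}" "horner ds = x div k"
    using Suc.IH by blast
  then show ?case using k_ge by (intro exI[of _ "ds @ [x mod k]"]) auto
qed simp

text \<open>The residue of the low part comes first: in this order a move by \<open>\<sigma>\<close> takes \<open>w # ds\<close> to
  \<open>ds @ [\<lceil>w / t\<rceil>]\<close>.\<close>

definition code :: "nat list \<Rightarrow> nat" where
  "code W = horner (tl W) * (k * t) + hd W"

text \<open>Nonzero letters keep the residue nonzero whichever letter becomes the head, as
  \<open>orb_low_parts\<close> requires.\<close>

definition words :: "nat list set" where
  "words = {W. length W = Suc s \<and> set W \<subseteq> {1..<k}}"

definition ceil_div :: "nat \<Rightarrow> nat" where
  "ceil_div w = (w + (t - 1)) div t"

lemma ceil_div_bounds: "w \<le> ceil_div w * t" "ceil_div w * t < w + t"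
proof -
  have t: "0 < t" using t_gt by simp
  have "w + (t - 1) < (w + (t - 1)) div t * t + t" 
    using dividend_less_div_times[OF t] by (simp add: add.commute)
  then show "w \<le> ceil_div w * t" unfolding ceil_div_def by linarith
  have "(w + (t - 1)) div t * t \<le> w + (t - 1)" by (rule div_times_less_eq_dividend)
  then show "ceil_div w * t < w + t" using t unfolding ceil_div_def by linarith
qed

lemma ceil_div_pos: "w \<ge> 1 \<Longrightarrow> ceil_div w \<ge> 1"
  using ceil_div_bounds(1)[of w] by (cases "ceil_div w") auto

lemma ceil_div_le: "ceil_div w \<le> w"
proof (rule ccontr)
  assume "\<not> ceil_div w \<le> w"
  then have "(w + 1) * t \<le> ceil_div w * t" by (intro mult_le_mono1) simp
  then have "(w + 1) * t < w + t" using ceil_div_bounds(2)[of w] by (rule le_less_trans)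
  then have "w * t < w" by (simp add: algebra_simps)
  then show False using t_gt by simp
qed

text \<open>For \<open>w, t \<ge> 2\<close>, \<open>(w - 1) * (t - 1) \<ge> 1\<close> gives
  \<open>w + t \<le> w * t\<close>, against \<open>ceil_div w * t < w + t\<close>.\<close>

lemma ceil_div_less: "w \<ge> 2 \<Longrightarrow> ceil_div w < w"
proof (rule ccontr)
  assume w: "w \<ge> 2" "\<not> ceil_div w < w"
  then have "w * t \<le> ceil_div w * t" by (intro mult_le_mono1) simp
  then have "w * t < w + t" using ceil_div_bounds(2)[of w] by (rule le_less_trans)
  moreover have "w = w - 2 + 2" "t = t - 2 + 2" using w(1) t_gt by auto
  then obtain a b where "w = a + 2" "t = b + 2" by blast
  ultimately show False by simp
qed

lemma set_words: "W \<in> words \<Longrightarrow> set (map ceil_div W) \<subseteq> {1..<k}"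
proof -
  assume "W \<in> words"
  then have "1 \<le> ceil_div w \<and> ceil_div w < k" if "w \<in> set W" for w
    using that ceil_div_pos[of w] ceil_div_le[of w] by (force simp: words_def)
  then show ?thesis by auto
qed

lemma code_in_Omega: "W \<in> words \<Longrightarrow> code W \<in> Omega k n"
proof -
  assume W: "W \<in> words"
  then have "set (tl W) \<subseteq> {..<k}" by (cases W) (auto simp: words_def)
  then have "horner (tl W) < k ^ s" using horner_less[of "tl W"] W by (simp add: words_def)
  moreover have "hd W < k * t"
  proof -
    have "hd W < k" using W by (cases W) (auto simp: words_def)
    then show ?thesis using t_gt by (simp add: less_le_trans)
  qed
  ultimately show ?thesis unfolding code_def by (rule point_in_Omega)
qed

lemma zero_in_Omega: "0 \<in> Omega k n"
  using k_ge t_gt by (simp add: Omega_def n_eq)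

section \<open>Rewriting words by \<open>sigma\<close>\<close>

text \<open>Raise both low parts by \<open>c\<close>, so that the second becomes
  \<open>ceil_div w * t\<close>; apply \<open>sigma\<close>; clear the first low part. As
  \<open>sigma\<close> multiplies by \<open>k\<close>, \<open>ceil_div w\<close> carries into the
  upper part, whose old leading digit becomes the residue.\<close>

lemma step_word:
  assumes "w # ds \<in> words"
  shows "orb k n (0, code (w # ds)) (0, code (ds @ [ceil_div w]))"
proof -
  have len: "length ds = s" and w: "1 \<le> w" "w < k" and ds: "set ds \<subseteq> {1..<k}"
    using assms by (auto simp: words_def)
  \<comment> \<open>Rounding up gives \<open>c < t \<le> n\<close>, so \<open>c\<close> has leading
    digit 0 and \<open>sigma\<close> sends it to \<open>k * c\<close>, which vanishes modulo
    \<open>k\<close>.\<close>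
  define c where "c = ceil_div w * t - w"
  have c: "c < t" "c + w = ceil_div w * t" using ceil_div_bounds[of w] by (auto simp: c_def)
  have gw: "ceil_div w < k" using ceil_div_le[of w] w by simp
  have gwt: "ceil_div w * t < k * t" using gw t_gt by simp
  have ct: "c < k * t" using c(1) k_ge by (simp add: less_le_trans)
  have kc: "k * c < k * t" using c(1) k_ge by simp
  have wt: "w < k * t" using w(2) t_gt by (simp add: less_le_trans)
  have k0: "0 < k ^ s" using k_ge by simp
  have "1 * t \<le> k ^ s * t" by (intro mult_le_mono1) (use k0 in linarith)
  then have t_le: "t \<le> n" using n_eq by simp
  have h: "horner ds < k ^ s" using horner_less[of ds] ds len by fastforce
  have "orb k n (0 * (k * t) + 0, horner ds * (k * t) + w)
      (0 * (k * t) + c, horner ds * (k * t) + ceil_div w * t)"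
  proof (rule orb_low_parts[OF k0 h _ wt ct gwt])
    show "0 < k * t" using k_ge t_gt by simp
    show "0 mod k \<noteq> w mod k" using w by simp
    show "(int w - int 0) mod int k = (int (ceil_div w * t) - int c) mod int k"
      by (simp flip: c(2))
  qed
  then have 1: "orb k n (0, code (w # ds)) (c, horner ds * (k * t) + ceil_div w * t)"
    by (simp add: code_def)
  have sigma_c: "sigma k n c = k * c"
    using sigma_apply[of 0 k c n] c(1) t_le k_ge by simp
  have "\<exists>\<beta> v. code (ds @ [ceil_div w]) = \<beta> * (k * t) + v \<and> \<beta> < k ^ s \<and> 1 \<le> v \<and> v < k
      \<and> sigma k n (horner ds * (k * t) + ceil_div w * t) = \<beta> * (k * t) + v"
  proof (cases ds)
    \<comment> \<open>Without upper digits \<open>n = t\<close>, so \<open>ceil_div w\<close> is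
      itself the leading digit that \<open>sigma\<close> moves to the end.\<close>
    case Nil
    then have "n = t" using n_eq len by simp
    then show ?thesis
      using sigma_apply[of "ceil_div w" k 0 n] t_gt gw ceil_div_pos[OF w(1)] Nil k0
      by (intro exI[of _ 0] exI[of _ "ceil_div w"]) (simp add: code_def)
  next
    case (Cons b bs)
    then have b: "1 \<le> b" "b < k" and bs: "set bs \<subseteq> {..<k}" and s: "s = Suc (length bs)"
      using ds len by auto
    have "k ^ length bs * (k * t) = n" using n_eq s by simp
    from sigma_drop_digit[OF this b(2) horner_less[OF bs] gwt]
    have "sigma k n (horner ds * (k * t) + ceil_div w * t) =
        (horner bs * k + ceil_div w) * (k * t) + b"
      using Cons by (simp add: horner_Cons algebra_simps)
    moreover have "set (bs @ [ceil_div w]) \<subseteq> {..<k}" using bs gw by simp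
    then have "horner (bs @ [ceil_div w]) < k ^ s" using horner_less s by fastforce
    ultimately show ?thesis using Cons b
      by (intro exI[of _ "horner (bs @ [ceil_div w])"] exI[of _ b]) (simp add: code_def)
  qed
  then obtain \<beta> v where code: "code (ds @ [ceil_div w]) = \<beta> * (k * t) + v" and \<beta>: "\<beta> < k ^ s"
    and v: "1 \<le> v" "v < k"
    and sigma: "sigma k n (horner ds * (k * t) + ceil_div w * t) = \<beta> * (k * t) + v" by blast
  have vt: "v < k * t" using v(2) t_gt by (simp add: less_le_trans)
  have 2: "orb k n (c, horner ds * (k * t) + ceil_div w * t) (k * c, \<beta> * (k * t) + v)"
    using orb_sigma[of k n c] sigma sigma_c by metis
  have "orb k n (0 * (k * t) + k * c, \<beta> * (k * t) + v) (0 * (k * t) + 0, \<beta> * (k * t) + v)"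
  proof (rule orb_low_parts[OF k0 \<beta> kc vt _ vt])
    show "0 < k * t" using k_ge t_gt by simp
    show "(k * c) mod k \<noteq> v mod k" using v by simp
    show "(int v - int (k * c)) mod int k = (int v - int 0) mod int k"
      by (simp add: mod_diff_right_eq[symmetric])
  qed
  then have 3: "orb k n (k * c, \<beta> * (k * t) + v) (0, code (ds @ [ceil_div w]))" by (simp add: code)
  note \<Omega> = zero_in_Omega code_in_Omega[OF assms]
  show ?thesis
    by (rule orb_trans[OF orb_trans[OF 1 2 \<Omega>] 3 \<Omega>])
qed

text \<open>\<open>bs\<close> is arbitrary because each processed letter is appended to it;
  \<open>bs = []\<close> gives a full sweep.\<close>

lemma sweep_word:
  assumes "as @ bs \<in> words"
  shows "orb k n (0, code (as @ bs)) (0, code (bs @ map ceil_div as))"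
  using assms
proof (induction as arbitrary: bs)
  case Nil
  then show ?case using code_in_Omega zero_in_Omega by (auto intro: orb_refl)
next
  case (Cons a as)
  then have "orb k n (0, code (a # as @ bs)) (0, code (as @ bs @ [ceil_div a]))"
    using step_word[of a "as @ bs"] by simp
  moreover have "as @ bs @ [ceil_div a] \<in> words"
    using Cons.prems set_words[OF Cons.prems] by (simp add: words_def)
  then have "orb k n (0, code (as @ bs @ [ceil_div a])) (0, code (bs @ ceil_div a # map ceil_div as))"
    using Cons.IH[of "bs @ [ceil_div a]"] by simp
  ultimately have "orb k n (0, code (a # as @ bs)) (0, code (bs @ ceil_div a # map ceil_div as))"
    by (rule orb_trans) (use zero_in_Omega code_in_Omega[OF Cons.prems] in simp_all)
  then show ?case by simp
qed

text \<open>Letters never grow, and a word other than all ones has a letter \<ge> 2, which shrinks.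
  The letter sum is the measure that ends the sweeps.\<close>

lemma sum_map_ceil_div_less:
  "W \<in> words \<Longrightarrow> W \<noteq> replicate (Suc s) 1 \<Longrightarrow> sum_list (map ceil_div W) < sum_list W"
proof -
  have le: "sum_list (map ceil_div W) \<le> sum_list W" for W
    using sum_list_mono[of W ceil_div "\<lambda>x. x"] ceil_div_le by simp
  have "sum_list (map ceil_div W) < sum_list W" if "x \<in> set W" "x \<ge> 2" for x W
    using that
  proof (induction W)
    case (Cons y W)
    then show ?case
      using ceil_div_less[of x] le[of W] ceil_div_le[of y] by (auto simp: add_less_le_mono add_le_less_mono)
  qed simp
  moreover assume W: "W \<in> words" "W \<noteq> replicate (Suc s) 1"
  then have "\<exists>x \<in> set W. x \<noteq> 1" using replicate_eqI[of W "Suc s" 1] by (auto simp: words_def)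
  then obtain x where x: "x \<in> set W" "x \<noteq> 1" by blast
  with W(1) have "x \<ge> 1" by (auto simp: words_def)
  with x have "\<exists>x \<in> set W. x \<ge> 2" by (intro bexI[of _ x]) auto
  ultimately show ?thesis by blast
qed

lemma orb_code_ones:
  assumes "W \<in> words"
  shows "orb k n (0, code W) (0, code (replicate (Suc s) 1))"
  using assms
proof (induction "sum_list W" arbitrary: W rule: less_induct)
  case less
  show ?case
  proof (cases "W = replicate (Suc s) 1")
    case True
    then show ?thesis using code_in_Omega[OF less.prems] zero_in_Omega by (auto intro: orb_refl)
  next
    case False
    have "map ceil_div W \<in> words" using less.prems set_words[OF less.prems] by (simp add: words_def)
    with less.hyps[OF sum_map_ceil_div_less[OF less.prems False]]
    have "orb k n (0, code (map ceil_div W)) (0, code (replicate (Suc s) 1))" by blast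
    with sweep_word[of W "[]"] less.prems show ?thesis
      using orb_trans zero_in_Omega code_in_Omega[OF less.prems] by simp
  qed
qed

section \<open>Reduction of a pair to a word\<close>

text \<open>One step back along \<open>sigma\<close>: the last upper digits \<open>a\<close>,
  \<open>b\<close> drop into the low parts, while \<open>0\<close> and \<open>r\<close> become
  leading digits. The first point gains a zero, the second a nonzero letter.\<close>

lemma unwind_digit:
  assumes len: "Suc (length A) = s" "length B = length A"
    and digits: "set A \<subseteq> {..<k}" "set B \<subseteq> {..<k}" "a < k" "b < k" "1 \<le> r" "r < k"
  shows "\<exists>r'\<in>{1..<k}. orb k n
    (horner (A @ [a]) * (k * t), horner (B @ [b]) * (k * t) + r)
    (horner (0 # A) * (k * t), horner (r # B) * (k * t) + r')"
proof -
  \<comment> \<open>Replacing the low part \<open>r\<close> by \<open>e * k + r\<close> keeps the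
    residue. Undoing \<open>sigma\<close> then leaves low parts \<open>a * t\<close> and
    \<open>b * t + e\<close>, which \<open>e\<close> makes differ modulo \<open>k\<close>;
    \<open>e = 1\<close> is admissible as \<open>t > 1\<close>.\<close>
  define e where "e = (if (b * t) mod k = (a * t) mod k then 1 else 0 :: nat)"
  have e_lt: "e < t" using t_gt by (simp add: e_def)
  have e: "(a * t) mod k \<noteq> (b * t + e) mod k"
  proof (cases "(b * t) mod k = (a * t) mod k")
    case True
    then have "(b * t + e) mod k = (a * t + 1) mod k"
      by (metis e_def mod_add_left_eq)
    then show ?thesis using k_ge mod_Suc[of "a * t" k] by auto
  qed (simp add: e_def)
  define r' where "r' = nat ((int (b * t + e) - int (a * t)) mod int k)"
  have r'_int: "int r' = (int (b * t + e) - int (a * t)) mod int k"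
    using k_ge by (simp add: r'_def)
  have "\<not> int k dvd int (b * t + e) - int (a * t)"
    using e by (metis mod_eq_dvd_iff of_nat_eq_iff zmod_int)
  then have "int r' \<noteq> 0" "int r' < int k"
    using r'_int k_ge by (auto simp: dvd_eq_mod_eq_0)
  then have r': "r' \<in> {1..<k}" by auto
  have split: "k ^ length A * (k * t) = n" "k ^ length B * (k * t) = n"
    using n_eq len(2) by (simp_all flip: len(1))
  have h: "horner (A @ [a]) < k ^ s" "horner (B @ [b]) < k ^ s" "horner (0 # A) < k ^ s"
    "horner (r # B) < k ^ s"
    using horner_less[of "A @ [a]"] horner_less[of "B @ [b]"] horner_less[of "0 # A"]
      horner_less[of "r # B"] digits len(2) by (simp_all flip: len(1))
  have at: "a * t < k * t" using digits t_gt by simp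
  have bt: "b * t + e < k * t" using Omega_memI[OF digits(4) e_lt] by (simp add: Omega_def)
  have ekr: "e * k + r < k * t" using Omega_memI[OF e_lt digits(6)] by (simp add: Omega_def ac_simps)
  have rt: "r < k * t" "r' < k * t" using digits r' t_gt by (auto simp: less_le_trans)
  have kt0: "0 < k * t" using k_ge t_gt by simp
  define x where "x = horner (0 # A) * (k * t) + a * t"
  define y where "y = horner (r # B) * (k * t) + (b * t + e)"
  have \<Omega>: "x \<in> Omega k n" "y \<in> Omega k n" unfolding x_def y_def
    using h at bt by (auto intro: point_in_Omega)
  have "sigma k n x = horner (A @ [a]) * (k * t)"
    using sigma_drop_digit[OF split(1) _ horner_less[OF digits(1)] at, of 0] k_ge
    by (simp add: x_def horner_Cons algebra_simps)
  moreover have "sigma k n y = horner (B @ [b]) * (k * t) + (e * k + r)"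
    using sigma_drop_digit[OF split(2) digits(6) horner_less[OF digits(2)] bt]
    by (simp add: y_def horner_Cons algebra_simps)
  ultimately have 2: "orb k n (horner (A @ [a]) * (k * t), horner (B @ [b]) * (k * t) + (e * k + r))
      (x, y)" using orb_sym[OF orb_sigma \<Omega>] by simp
  have "orb k n (horner (A @ [a]) * (k * t) + 0, horner (B @ [b]) * (k * t) + r)
      (horner (A @ [a]) * (k * t) + 0, horner (B @ [b]) * (k * t) + (e * k + r))"
    using digits by (intro orb_low_parts h kt0 rt ekr) auto
  then have 1: "orb k n (horner (A @ [a]) * (k * t), horner (B @ [b]) * (k * t) + r)
      (horner (A @ [a]) * (k * t), horner (B @ [b]) * (k * t) + (e * k + r))" by simp
  have "orb k n (x, y) (horner (0 # A) * (k * t) + 0, horner (r # B) * (k * t) + r')"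
    unfolding x_def y_def by (rule orb_low_parts[OF h(3,4) at bt kt0 rt(2) e]) (simp add: r'_int)
  then have 3: "orb k n (x, y) (horner (0 # A) * (k * t), horner (r # B) * (k * t) + r')" by simp
  have \<Omega>': "horner (A @ [a]) * (k * t) \<in> Omega k n" "horner (B @ [b]) * (k * t) + r \<in> Omega k n"
    using point_in_Omega[OF h(1) kt0] point_in_Omega[OF h(2) rt(1)] by auto
  show ?thesis using orb_trans[OF orb_trans[OF 1 2 \<Omega>'] 3 \<Omega>'] r' by blast
qed

text \<open>\<open>A\<close> and \<open>B\<close> hold the digits still to be unwound; the zeros and
  \<open>ws\<close> in front are already produced. At \<open>j = 0\<close> the points are 0 and
  \<open>code (r # ws)\<close>.\<close>

lemma unwind_word:
  assumes "length A = j" "length B = j" "set A \<subseteq> {..<k}" "set B \<subseteq> {..<k}"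
    and "length ws = i" "set ws \<subseteq> {1..<k}" "i + j = s" "1 \<le> r" "r < k"
  shows "\<exists>W \<in> words. orb k n
    (horner (replicate i 0 @ A) * (k * t), horner (ws @ B) * (k * t) + r) (0, code W)"
  using assms
proof (induction j arbitrary: A B ws i r)
  case 0
  then have W: "r # ws \<in> words" by (auto simp: words_def)
  then show ?case using 0 orb_refl[OF zero_in_Omega code_in_Omega[OF W]]
    by (intro bexI[OF _ W]) (simp add: code_def)
next
  case (Suc j)
  obtain A' a where A: "A = A' @ [a]" using Suc.prems(1) by (cases A rule: rev_cases) auto
  obtain B' b where B: "B = B' @ [b]" using Suc.prems(2) by (cases B rule: rev_cases) auto
  let ?A = "replicate i 0 @ A'" and ?B = "ws @ B'"
  obtain r' where r': "r' \<in> {1..<k}" and step: "orb k n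
    (horner (?A @ [a]) * (k * t), horner (?B @ [b]) * (k * t) + r)
    (horner (0 # ?A) * (k * t), horner (r # ?B) * (k * t) + r')"
  proof -
    have "set ?A \<subseteq> {..<k}" "set ?B \<subseteq> {..<k}" "Suc (length ?A) = s" "length ?B = length ?A"
      using Suc.prems k_ge by (auto simp: A B)
    moreover have "a < k" "b < k" using Suc.prems by (auto simp: A B)
    ultimately show thesis
      using unwind_digit[of ?A ?B a b r] Suc.prems(8,9) that by blast
  qed
  have "\<exists>W \<in> words. orb k n
    (horner (replicate (Suc i) 0 @ A') * (k * t), horner ((r # ws) @ B') * (k * t) + r') (0, code W)"
    using Suc.prems r' by (intro Suc.IH) (auto simp: A B)
  then obtain W where W: "W \<in> words" and rest: "orb k n
    (horner (0 # ?A) * (k * t), horner (r # ?B) * (k * t) + r') (0, code W)" by auto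
  have "set (?A @ [a]) \<subseteq> {..<k}" "set (?B @ [b]) \<subseteq> {..<k}" "length (?A @ [a]) = s"
    "length (?B @ [b]) = s"
    using Suc.prems k_ge by (auto simp: A B)
  then have h: "horner (?A @ [a]) < k ^ s" "horner (?B @ [b]) < k ^ s"
    using horner_less by metis+
  have "r < k * t" using Suc.prems t_gt by (auto simp: less_le_trans)
  then have "horner (?A @ [a]) * (k * t) \<in> Omega k n" "horner (?B @ [b]) * (k * t) + r \<in> Omega k n"
    using point_in_Omega[OF h(1), of 0] point_in_Omega[OF h(2)] k_ge t_gt by auto
  from orb_trans[OF step rest this] W show ?case by (auto simp: A B)
qed

text \<open>If the leading digits differ, \<open>sigma\<close> makes them the last digits. Otherwise
  it multiplies the distance by \<open>k\<close>, which must stay below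
  \<open>k * n\<close>.\<close>

lemma orb_distinct_low_digits:
  assumes "x \<in> Omega k n" "y \<in> Omega k n" "x \<noteq> y"
  shows "\<exists>x' y'. orb k n (x, y) (x', y') \<and> x' mod k \<noteq> y' mod k"
  using assms
\<comment> \<open>With truncated subtraction, \<open>(x - y) + (y - x)\<close> is the distance of
  \<open>x\<close> and \<open>y\<close>.\<close>
proof (induction "k * n - ((x - y) + (y - x))" arbitrary: x y rule: less_induct)
  case less
  note \<Omega> = less.prems(1,2)
  show ?case
  proof (cases "x div n = y div n")
    case False
    have "(sigma k n x) mod k = x div n" "(sigma k n y) mod k = y div n"
      using \<Omega> by (auto simp: sigma_def Omega_def less_mult_imp_div_less)
    then show ?thesis using False orb_sigma by metis
  next
    case True
    define d where "d = (x - y) + (y - x)"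
    have "sigma k n x - sigma k n y = k * (x - y)" "sigma k n y - sigma k n x = k * (y - x)"
    proof -
      have "x - y = x mod n - y mod n" "y - x = y mod n - x mod n"
        using True by (metis diff_add_inverse diff_diff_add mult_div_mod_eq)+
      then show "sigma k n x - sigma k n y = k * (x - y)" "sigma k n y - sigma k n x = k * (y - x)"
        using True \<Omega> by (auto simp: sigma_def diff_mult_distrib2)
    qed
    then have dist: "(sigma k n x - sigma k n y) + (sigma k n y - sigma k n x) = k * d"
      by (simp add: d_def distrib_left)
    have "d > 0" "d < k * n" using less.prems by (auto simp: d_def Omega_def)
    moreover from \<open>d > 0\<close> have "d < k * d" using k_ge by simp
    ultimately have "k * n - k * d < k * n - d" by linarith
    moreover have "sigma k n x \<noteq> sigma k n y" using dist \<open>d > 0\<close> k_ge by auto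
    ultimately obtain x' y' where "orb k n (sigma k n x, sigma k n y) (x', y')" "x' mod k \<noteq> y' mod k"
      using less.hyps[of "sigma k n x" "sigma k n y"] dist sigma_in_Omega \<Omega> unfolding d_def by auto
    then show ?thesis using orb_trans[OF orb_sigma] \<Omega> by blast
  qed
qed

text \<open>Separate the last digits, clear the first low part, unwind all upper digits, and sweep
  the resulting word to ones.\<close>

lemma orb_code:
  assumes "x \<in> Omega k n" "y \<in> Omega k n" "x \<noteq> y"
  shows "orb k n (x, y) (0, code (replicate (Suc s) 1))"
proof -
  obtain x' y' where 1: "orb k n (x, y) (x', y')" and low: "x' mod k \<noteq> y' mod k"
    using orb_distinct_low_digits[OF assms] by blast
  have kt: "k * t > 0" using k_ge t_gt by simp
  have "\<exists>\<alpha> m. \<alpha> < k ^ s \<and> m < k * t \<and> z = \<alpha> * (k * t) + m" if "z \<in> Omega k n" for z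
  proof -
    have "z \<in> Omega (k ^ s) (k * t)" using that by (simp add: Omega_def n_eq ac_simps)
    then show ?thesis by (blast elim: Omega_memE)
  qed
  then obtain \<alpha> m \<beta> m' where m: "\<alpha> < k ^ s" "m < k * t" "x' = \<alpha> * (k * t) + m"
    and m': "\<beta> < k ^ s" "m' < k * t" "y' = \<beta> * (k * t) + m'"
    using orb_in_Omega[OF 1 assms(1,2)] by metis
  have mm: "m mod k \<noteq> m' mod k" using low m(3) m'(3)
    by (metis mod_mult_self3 mult.assoc mult.commute)
  define r where "r = nat ((int m' - int m) mod int k)"
  have r_int: "int r = (int m' - int m) mod int k" using k_ge by (simp add: r_def)
  have "\<not> int k dvd int m' - int m" using mm by (metis mod_eq_dvd_iff of_nat_eq_iff zmod_int)
  then have "int r \<noteq> 0" "int r < int k" using r_int k_ge by (auto simp: dvd_eq_mod_eq_0)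
  then have r: "1 \<le> r" "r < k" by auto
  then have rt: "r < k * t" using t_gt by (auto simp: less_le_trans)
  have "orb k n (x', y') (\<alpha> * (k * t) + 0, \<beta> * (k * t) + r)"
    unfolding m(3) m'(3)
    by (rule orb_low_parts[OF m(1) m'(1) m(2) m'(2) kt rt mm]) (simp add: r_int)
  then have 2: "orb k n (x', y') (\<alpha> * (k * t), \<beta> * (k * t) + r)" by simp
  obtain A B where "length A = s" "set A \<subseteq> {..<k}" "horner A = \<alpha>"
    "length B = s" "set B \<subseteq> {..<k}" "horner B = \<beta>"
    using ex_horner[OF m(1)] ex_horner[OF m'(1)] by blast
  then obtain W where W: "W \<in> words" and 3: "orb k n (\<alpha> * (k * t), \<beta> * (k * t) + r) (0, code W)"
    using unwind_word[of A s B "[]" 0 r] r by auto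
  note \<Omega> = assms(1,2)
  show ?thesis
    by (rule orb_trans[OF orb_trans[OF orb_trans[OF 1 2 \<Omega>] 3 \<Omega>] orb_code_ones[OF W] \<Omega>])
qed

lemma two_transitive: "two_transitive_on (H k n) (Omega k n)"
proof -
  have "orb k n (x, y) (x', y')"
    if "x \<in> Omega k n" "y \<in> Omega k n" "x' \<in> Omega k n" "y' \<in> Omega k n" "x \<noteq> y" "x' \<noteq> y'"
    for x y x' y'
    using orb_trans[OF orb_code orb_sym[OF orb_code]] that by simp
  then show ?thesis by (force simp: two_transitive_on_def orb_def)
qed

end

theorem theorem1p3:
  fixes k n s t :: nat
  assumes "k \<ge> 3" and "n \<ge> 1"
    and "n = k ^ s * t" and "\<not> k dvd t" and "t > 1"
    and "lam k t \<ge> 3"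
  shows "two_transitive_on (H k n) (Omega k n)"
proof -
  interpret cyclic_shuffle k n s t using assms by unfold_locales
  show ?thesis by (rule two_transitive)
qed

end
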